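(* Let $P\in\mathbb{R}^{n\times n}$ be a stochastic, irreducible and aperiodic matrix with stationary distribution $\pi$ which is reversible, i.e. $\pi_iP_{ij}=\pi_jP_{ji}$ for all $i,j$. Let $\pi_{\min}=\min_i\pi_i$ and $\pi_{\max}=\max_i\pi_i$. Then for the noisy consensus iteration $x(t+1)=Px(t)+w(t)$ with noise covariance $\mathrm{diag}(\sigma_1^2,\dots,\sigma_n^2)$, the unweighted steady-state disagreement satisfies $$\frac{1}{n\pi_{\max}}\sum_{i=1}^n\sum_{j=1}^n\sigma_i^2\pi_i^2\pi_jH_{P^2}(j\to i)\ \le\ \delta^{\rm uni}_{\rm ss}\left(P,\mathrm{diag}(\sigma_1^2,\dots,\sigma_n^2)\right)\ \le\ \frac{1}{n\pi_{\min}}\sum_{i=1}^n\sum_{j=1}^n\sigma_i^2\pi_i^2\pi_jH_{P^2}(j\to i).$$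
   Context: The stationary distribution $\pi$ of $P$ is the unique vector with $\pi^TP=\pi^T$, $\sum_i\pi_i=1$. Noisy consensus: $x(t+1)=Px(t)+w(t)$, $t=0,1,2,\dots$, with $x(0)=0$ and $w(0),w(1),\dots$ i.i.d. (in time) zero-mean random vectors in $\mathbb{R}^n$ with covariance matrix $\Sigma_w=E[w(t)w(t)^T]$. Weighted average vector: $\overline{x}(t)=\left(\sum_i\pi_ix_i(t)\right)\mathbf{1}$, where $\mathbf{1}$ is the all-ones vector; error vector: $e(t)=x(t)-\overline{x}(t)$. Unweighted steady-state disagreement: $\delta^{\rm uni}_{\rm ss}(P,\Sigma_w)=\limsup_{t\to\infty}\frac1n\sum_{i=1}^nE[e_i^2(t)]$. Hitting times: for a stochastic matrix $M$, $H_M(i\to j)$ is the expected time until the Markov chain with transition matrix $M$ started at $i$ visits $j$ for the first time, with $H_M(i\to i)=0$. *)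

theory Defs
  imports "HOL-Probability.Probability"
begin

section \<open>Stochastic matrices\<close>

definition stochastic_matrix :: "real^'n^'n \<Rightarrow> bool" where
  "stochastic_matrix P \<longleftrightarrow> (\<forall>i j. 0 \<le> P $ i $ j) \<and> (\<forall>i. (\<Sum>j\<in>UNIV. P $ i $ j) = 1)"

(* The power operator of class monoid_mult acts entrywise on real^'n^'n. *)
primrec matrix_power :: "real^'n^'n \<Rightarrow> nat \<Rightarrow> real^'n^'n" where
  "matrix_power P 0 = mat 1"
| "matrix_power P (Suc k) = P ** matrix_power P k"

definition irreducible_matrix :: "real^'n^'n \<Rightarrow> bool" where
  "irreducible_matrix P \<longleftrightarrow> (\<forall>i j. \<exists>k. 0 < matrix_power P k $ i $ j)"

definition aperiodic_matrix :: "real^'n^'n \<Rightarrow> bool" where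
  "aperiodic_matrix P \<longleftrightarrow> (\<forall>i. Gcd {k. 0 < k \<and> 0 < matrix_power P k $ i $ i} = 1)"

definition stationary_distribution :: "real^'n^'n \<Rightarrow> real^'n \<Rightarrow> bool" where
  "stationary_distribution P \<pi> \<longleftrightarrow> \<pi> v* P = \<pi> \<and> (\<Sum>i\<in>UNIV. \<pi> $ i) = 1"

definition reversible_matrix :: "real^'n^'n \<Rightarrow> real^'n \<Rightarrow> bool" where
  "reversible_matrix P \<pi> \<longleftrightarrow> (\<forall>i j. \<pi> $ i * P $ i $ j = \<pi> $ j * P $ j $ i)"

definition diagonal_matrix :: "('n \<Rightarrow> real) \<Rightarrow> real^'n^'n" where
  "diagonal_matrix d = (\<chi> i j. if i = j then d i else 0)"


section \<open>Markov chains and hitting times\<close>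

(* Law of the state at time t, given the trajectory w up to time t - 1, of the chain
   with transition matrix M started at i. *)
definition chain_kernel :: "real^'n^'n \<Rightarrow> 'n \<Rightarrow> nat \<Rightarrow> (nat \<Rightarrow> 'n) \<Rightarrow> 'n measure" where
  "chain_kernel M i t w =
     (case t of 0 \<Rightarrow> return (count_space UNIV) i
      | Suc s \<Rightarrow> point_measure UNIV (\<lambda>j. ennreal (M $ w s $ j)))"

(* Law of the whole trajectory: the Ionescu-Tulcea extension of these kernels.
   The lemma emeasure_markov_chain below gives its finite-dimensional distributions. *)
definition markov_chain :: "real^'n^'n \<Rightarrow> 'n \<Rightarrow> (nat \<Rightarrow> 'n) measure" where
  "markov_chain M i =
     projective_family.lim UNIV
       (Ionescu_Tulcea.CI (chain_kernel M i) (\<lambda>_. count_space UNIV)) (\<lambda>_. count_space UNIV)"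

(* The infimum over the empty set is \<infinity>: a trajectory that never visits j has infinite
   first visit time. *)
definition first_visit :: "'n \<Rightarrow> (nat \<Rightarrow> 'n) \<Rightarrow> ennreal" where
  "first_visit j w = (INF t\<in>{t. w t = j}. of_nat t)"

definition hitting_time :: "real^'n^'n \<Rightarrow> 'n \<Rightarrow> 'n \<Rightarrow> ennreal" where
  "hitting_time M i j = (\<integral>\<^sup>+ w. first_visit j w \<partial>markov_chain M i)"


section \<open>Noisy consensus\<close>

definition iid_noise :: "'a measure \<Rightarrow> (nat \<Rightarrow> 'a \<Rightarrow> real^'n) \<Rightarrow> real^'n^'n \<Rightarrow> bool" where
  "iid_noise \<Omega> w S \<longleftrightarrow>
     prob_space \<Omega> \<and>
     prob_space.indep_vars \<Omega> (\<lambda>_. borel) w UNIV \<and>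
     (\<forall>s t. distr \<Omega> borel (w s) = distr \<Omega> borel (w t)) \<and>
     (\<forall>t. has_bochner_integral \<Omega> (w t) 0) \<and>
     (\<forall>t. has_bochner_integral \<Omega> (\<lambda>\<omega>. \<chi> i j. w t \<omega> $ i * w t \<omega> $ j) S)"

primrec consensus :: "real^'n^'n \<Rightarrow> (nat \<Rightarrow> 'a \<Rightarrow> real^'n) \<Rightarrow> nat \<Rightarrow> 'a \<Rightarrow> real^'n" where
  "consensus P w 0 \<omega> = 0"
| "consensus P w (Suc t) \<omega> = P *v consensus P w t \<omega> + w t \<omega>"

definition weighted_average :: "real^'n \<Rightarrow> real^'n \<Rightarrow> real^'n" where
  "weighted_average \<pi> x = (\<Sum>i\<in>UNIV. \<pi> $ i * x $ i) *\<^sub>R vec 1"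

definition consensus_error ::
  "real^'n^'n \<Rightarrow> real^'n \<Rightarrow> (nat \<Rightarrow> 'a \<Rightarrow> real^'n) \<Rightarrow> nat \<Rightarrow> 'a \<Rightarrow> real^'n" where
  "consensus_error P \<pi> w t \<omega> = consensus P w t \<omega> - weighted_average \<pi> (consensus P w t \<omega>)"

definition steady_state_disagreement ::
  "'a measure \<Rightarrow> real^'n^'n \<Rightarrow> real^'n \<Rightarrow> (nat \<Rightarrow> 'a \<Rightarrow> real^'n) \<Rightarrow> ennreal" where
  "steady_state_disagreement \<Omega> P \<pi> w =
     limsup (\<lambda>t. ennreal (1 / real CARD('n)) *
       (\<Sum>i\<in>UNIV. \<integral>\<^sup>+ \<omega>. ennreal ((consensus_error P \<pi> w t \<omega> $ i)\<^sup>2) \<partial>\<Omega>))"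


section \<open>Finite-dimensional distributions of the chain\<close>

lemma prob_space_chain_kernel:
  fixes M :: "real^'n^'n"
  assumes "stochastic_matrix M"
  shows "prob_space (chain_kernel M i t w)"
proof (cases t)
  case 0
  then show ?thesis by (simp add: chain_kernel_def prob_space_return)
next
  case (Suc s)
  have "(\<Sum>j\<in>UNIV. ennreal (M $ w s $ j)) = ennreal (\<Sum>j\<in>UNIV. M $ w s $ j)"
    using assms by (intro sum_ennreal) (auto simp: stochastic_matrix_def)
  also have "\<dots> = 1" using assms by (simp add: stochastic_matrix_def)
  finally show ?thesis using Suc
    by (auto simp: chain_kernel_def space_point_measure emeasure_point_measure_finite
        intro!: prob_spaceI)
qed

lemma Ionescu_Tulcea_chain_kernel:
  fixes M :: "real^'n^'n"
  assumes "stochastic_matrix M"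
  shows "Ionescu_Tulcea (chain_kernel M i) (\<lambda>_. count_space UNIV)"
proof (rule Ionescu_Tulcea.intro)
  show "prob_space (chain_kernel M i t w)" for t w
    by (rule prob_space_chain_kernel[OF assms])
  show "chain_kernel M i t \<in> measurable (PiM {0..<t} (\<lambda>_. count_space UNIV))
      (subprob_algebra (count_space UNIV))" for t
  proof (cases t)
    case 0
    then have "chain_kernel M i t = (\<lambda>w. return (count_space UNIV) i)"
      by (auto simp: chain_kernel_def)
    moreover have "subprob_space (return (count_space UNIV) i)"
      by (intro prob_space_imp_subprob_space prob_space_return) simp
    ultimately show ?thesis by (simp add: space_subprob_algebra)
  next
    case (Suc s)
    then have eq: "chain_kernel M i t = (\<lambda>k. point_measure UNIV (\<lambda>j. ennreal (M $ k $ j))) \<circ> (\<lambda>w. w s)"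
      by (auto simp: chain_kernel_def)
    have "prob_space (point_measure UNIV (\<lambda>j. ennreal (M $ k $ j)))" for k
      using prob_space_chain_kernel[OF assms, of i "Suc 0" "\<lambda>_. k"] by (simp add: chain_kernel_def)
    then have "(\<lambda>k. point_measure UNIV (\<lambda>j. ennreal (M $ k $ j))) \<in>
        measurable (count_space UNIV) (subprob_algebra (count_space UNIV))"
      by (auto simp: space_subprob_algebra sets_point_measure prob_space_imp_subprob_space)
    moreover have "(\<lambda>w. w s) \<in> measurable (PiM {0..<t} (\<lambda>_. count_space UNIV)) (count_space UNIV)"
      using Suc by (intro measurable_component_singleton) auto
    ultimately show ?thesis unfolding eq by (rule measurable_comp[rotated])
  qed
qed

lemma
  fixes M :: "real^'n^'n"
  assumes M: "stochastic_matrix M"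
  shows prob_space_markov_chain: "prob_space (markov_chain M i)"
    and sets_markov_chain: "sets (markov_chain M i) = sets (PiM UNIV (\<lambda>_. count_space UNIV))"
    and emeasure_markov_chain:
      "emeasure (markov_chain M i) {w. \<forall>s\<le>t. w s = a s} =
         (if a 0 = i then ennreal (\<Prod>s<t. M $ a s $ a (Suc s)) else 0)"
proof -
  interpret IT: Ionescu_Tulcea "chain_kernel M i" "\<lambda>_. count_space UNIV"
    by (rule Ionescu_Tulcea_chain_kernel[OF M])
  show "sets (markov_chain M i) = sets (PiM UNIV (\<lambda>_. count_space UNIV))"
    by (simp add: markov_chain_def IT.PF.sets_lim)
  let ?N = "\<lambda>n. PiM {0..<n} (\<lambda>_. count_space (UNIV :: 'n set))"
  show "prob_space (markov_chain M i)"
  proof (rule prob_spaceI)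
    have "prob_space (IT.CI {})" by (rule IT.PF.prob_space_P) auto
    then have "emeasure (IT.CI {}) (space (IT.CI {})) = 1" by (rule prob_space.emeasure_space_1)
    moreover have "space (IT.CI {}) = {\<lambda>x. undefined}"
      by (simp add: IT.CI_def space_PiM)
    moreover have "emeasure IT.PF.lim (IT.PF.emb UNIV {} {\<lambda>x. undefined}) = emeasure (IT.CI {}) {\<lambda>x. undefined}"
      by (rule IT.lim) (auto simp: sets_PiM_empty)
    moreover have "IT.PF.emb UNIV {} {\<lambda>x. undefined} = UNIV"
      by (auto simp: prod_emb_def restrict_def)
    moreover have "space IT.PF.lim = UNIV"
      by (simp add: IT.PF.space_lim space_PiM)
    ultimately show "emeasure (markov_chain M i) (space (markov_chain M i)) = 1"
      by (simp add: markov_chain_def)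
  qed
  let ?c = "\<lambda>t. {restrict a {0..<Suc t}}"
  have c_sets: "?c t \<in> sets (?N (Suc t))" for t
  proof -
    have "?c t = PiE {0..<Suc t} (\<lambda>s. {a s})"
      by (auto simp: PiE_iff extensional_def fun_eq_iff)
    also have "\<dots> \<in> sets (?N (Suc t))" by (intro sets_PiM_I_finite) auto
    finally show ?thesis .
  qed
  have u: "(\<lambda>_. undefined) \<in> space (?N 0)" by (auto simp: space_PiM)
  have C: "emeasure (IT.C 0 (Suc t) (\<lambda>_. undefined)) (?c t) =
      (if a 0 = i then ennreal (\<Prod>s<t. M $ a s $ a (Suc s)) else 0)" for t
  proof (induction t)
    case 0
    have "emeasure (IT.C 0 (Suc 0) (\<lambda>_. undefined)) (?c 0) =
        emeasure (IT.eP 0 (\<lambda>_. undefined)) (?c 0)"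
      using u IT.measurable_eP[of 0] by (simp add: bind_return)
    also have "\<dots> = emeasure (chain_kernel M i 0 (\<lambda>_. undefined)) ((\<lambda>x. (\<lambda>_. undefined)(0 := x)) -` ?c 0)"
      using IT.emeasure_eP[OF u c_sets[of 0]] by simp
    also have "(\<lambda>x. (\<lambda>_. undefined)(0 := x)) -` ?c 0 = {a 0}"
      by (auto simp: fun_eq_iff restrict_def split: if_splits)
    finally show ?case by (simp add: chain_kernel_def indicator_def)
  next
    case (Suc t)
    let ?C = "IT.C 0 (Suc t) (\<lambda>_. undefined)"
    have spC: "space ?C = space (?N (Suc t))" using IT.space_C[OF u, of "Suc t"] by simp
    have seC: "sets ?C = sets (?N (Suc t))" using IT.sets_C[OF u, of "Suc t"] by simp
    have "emeasure (IT.C 0 (Suc (Suc t)) (\<lambda>_. undefined)) (?c (Suc t)) =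
        (\<integral>\<^sup>+ w. emeasure (IT.eP (Suc t) w) (?c (Suc t)) \<partial>?C)"
      unfolding IT.C.simps(2)[of 0 "Suc t"] add_0
    proof (rule emeasure_bind)
      show "space ?C \<noteq> {}" unfolding spC by (simp add: space_PiM PiE_eq_empty_iff)
      show "IT.eP (Suc t) \<in> measurable ?C (subprob_algebra (?N (Suc (Suc t))))"
        unfolding measurable_cong_sets[OF seC refl] by (rule IT.measurable_eP)
    qed (rule c_sets)
    also have "\<dots> = (\<integral>\<^sup>+ w. ennreal (M $ a t $ a (Suc t)) * indicator (?c t) w \<partial>?C)"
    proof (rule nn_integral_cong)
      fix w assume "w \<in> space ?C"
      then have w: "w \<in> space (?N (Suc t))" by (simp only: spC)
      then have ext: "w \<in> extensional {0..<Suc t}" by (simp add: space_PiM PiE_iff)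
      have vim: "(\<lambda>x. w(Suc t := x)) -` ?c (Suc t) = (if w \<in> ?c t then {a (Suc t)} else {})"
      proof -
        have "w(Suc t := x) = restrict a {0..<Suc (Suc t)} \<longleftrightarrow> x = a (Suc t) \<and> w = restrict a {0..<Suc t}" for x
        proof
          assume eq: "w(Suc t := x) = restrict a {0..<Suc (Suc t)}"
          have "w s = restrict a {0..<Suc t} s" for s
            using fun_cong[OF eq, of s] ext by (cases "s < Suc t") (auto simp: extensional_def)
          then show "x = a (Suc t) \<and> w = restrict a {0..<Suc t}"
            using fun_cong[OF eq, of "Suc t"] by auto
        qed (auto simp: fun_eq_iff restrict_def)
        then show ?thesis by (simp add: vimage_def)
      qed
      have "emeasure (IT.eP (Suc t) w) (?c (Suc t)) =
          emeasure (chain_kernel M i (Suc t) w) ((\<lambda>x. w(Suc t := x)) -` ?c (Suc t))"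
        using IT.emeasure_eP[OF w c_sets[of "Suc t"]] by simp
      also have "\<dots> = ennreal (M $ a t $ a (Suc t)) * indicator (?c t) w"
        unfolding vim by (auto simp: chain_kernel_def emeasure_point_measure_finite)
      finally show "emeasure (IT.eP (Suc t) w) (?c (Suc t)) = ennreal (M $ a t $ a (Suc t)) * indicator (?c t) w" .
    qed
    also have "\<dots> = ennreal (M $ a t $ a (Suc t)) * emeasure ?C (?c t)"
      by (rule nn_integral_cmult_indicator) (simp only: seC c_sets)
    also have "\<dots> = (if a 0 = i then ennreal (\<Prod>s<Suc t. M $ a s $ a (Suc s)) else 0)"
    proof -
      have "0 \<le> M $ a t $ a (Suc t)" using M by (simp add: stochastic_matrix_def)
      then show ?thesis unfolding Suc.IH by (simp add: ennreal_mult' mult.commute)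
    qed
    finally show ?case .
  qed
  have "{w. \<forall>s\<le>t. w s = a s} = IT.PF.emb UNIV {0..<Suc t} (?c t)"
  proof -
    have "restrict w {0..<Suc t} = restrict a {0..<Suc t} \<longleftrightarrow> (\<forall>s\<le>t. w s = a s)" for w
      by (metis restrict_ext restrict_apply' atLeastLessThan_iff less_Suc_eq_le zero_le)
    then show ?thesis by (simp add: prod_emb_def vimage_def)
  qed
  then have "emeasure (markov_chain M i) {w. \<forall>s\<le>t. w s = a s} = emeasure (IT.CI {0..<Suc t}) (?c t)"
    unfolding markov_chain_def using IT.lim[OF _ c_sets[of t]] by simp
  also have "\<dots> = emeasure (IT.C 0 (Suc t) (\<lambda>_. undefined)) (IT.PF.emb {0..<Suc t} {0..<Suc t} (?c t))"
    by (rule IT.emeasure_CI) (auto intro: c_sets)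
  also have "IT.PF.emb {0..<Suc t} {0..<Suc t} (?c t) = ?c t"
    by (rule prod_emb_id) (auto simp: PiE_iff)
  finally show "emeasure (markov_chain M i) {w. \<forall>s\<le>t. w s = a s} =
         (if a 0 = i then ennreal (\<Prod>s<t. M $ a s $ a (Suc s)) else 0)"
    by (simp only: C)
qed

end

theory Submission
  imports Defs
begin

text \<open>
  Write \<open>Q = P\<^sup>2\<close>. The error is \<open>e(t) = (\<Sum>s<t. (P^(t-1-s) - 1 \<pi>\<^sup>T) w(s))\<close>, so its second moments are
  sums of squared entries of \<open>P^k - 1 \<pi>\<^sup>T\<close>. By reversibility, the squares in column \<open>l\<close> weighted by
  \<open>\<pi>\<close> add up to \<open>\<pi>\<^sub>l (Q^k\<^sub>l\<^sub>l - \<pi>\<^sub>l)\<close>. Decomposing the stationary chain of \<open>Q\<close> at its first visit to \<open>l\<close>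
  gives \<open>(\<Sum>k. Q^k\<^sub>l\<^sub>l - \<pi>\<^sub>l) = \<pi>\<^sub>l (\<Sum>j. \<pi>\<^sub>j H\<^sub>Q(j \<rightarrow> l))\<close>. Hence the \<open>\<pi>\<close>-weighted disagreement increases to
  the double sum of the theorem; replacing the weights \<open>\<pi>\<^sub>i\<close> by \<open>1/n\<close> costs the two bounding factors.
\<close>

section \<open>Reversible stochastic matrices\<close>

lemma matrix_power_add: "matrix_power P (a + b) = matrix_power P a ** matrix_power P b"
  by (induction a) (simp_all add: matrix_mul_assoc)

lemma matrix_power_Suc_right: "matrix_power P (Suc k) = matrix_power P k ** P"
  using matrix_power_add[of P k 1] by simp

lemma matrix_power_square: "matrix_power (P ** P) k = matrix_power P k ** matrix_power P k"
proof (induction k)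
  case (Suc k)
  have "matrix_power (P ** P) (Suc k) = P ** (matrix_power P (Suc k) ** matrix_power P k)"
    using Suc by (simp add: matrix_mul_assoc)
  also have "\<dots> = matrix_power P (Suc k) ** matrix_power P (Suc k)"
    unfolding matrix_power_add[symmetric] matrix_power.simps(2)[symmetric] by simp
  finally show ?case .
qed simp

lemma stochastic_matrix_mult:
  assumes "stochastic_matrix A" "stochastic_matrix B"
  shows "stochastic_matrix (A ** B)"
proof -
  have "(\<Sum>j\<in>UNIV. \<Sum>k\<in>UNIV. A $ i $ k * B $ k $ j) = 1" for i
    using assms
    by (subst sum.swap) (simp add: sum_distrib_left[symmetric] stochastic_matrix_def)
  then show ?thesis
    using assms by (auto simp: stochastic_matrix_def matrix_matrix_mult_def intro!: sum_nonneg)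
qed

lemma stochastic_matrix_power:
  assumes "stochastic_matrix P"
  shows "stochastic_matrix (matrix_power P k)"
proof (induction k)
  case 0
  then show ?case by (simp add: stochastic_matrix_def mat_def)
qed (simp add: assms stochastic_matrix_mult)

lemma stationary_matrix_power:
  assumes "\<pi> v* P = \<pi>"
  shows "\<pi> v* matrix_power P k = \<pi>"
  by (induction k) (simp_all add: assms flip: vector_matrix_mul_assoc)

text \<open>Detailed balance carries \<open>\<pi>\<close> across both factors and reverses their
  order; commutation restores the product.\<close>

lemma reversible_matrix_mult:
  assumes "reversible_matrix A \<pi>" "reversible_matrix B \<pi>" "A ** B = B ** A"
  shows "reversible_matrix (A ** B) \<pi>"
  unfolding reversible_matrix_def
proof (intro allI)
  fix i j
  have A: "\<pi> $ i * A $ i $ k = \<pi> $ k * A $ k $ i" and B: "\<pi> $ i * B $ i $ k = \<pi> $ k * B $ k $ i" for i k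
    using assms by (auto simp: reversible_matrix_def)
  have "\<pi> $ i * (A ** B) $ i $ j = (\<Sum>k\<in>UNIV. (\<pi> $ i * A $ i $ k) * B $ k $ j)"
    by (simp add: matrix_matrix_mult_def sum_distrib_left mult.assoc)
  also have "\<dots> = (\<Sum>k\<in>UNIV. (\<pi> $ k * B $ k $ j) * A $ k $ i)"
    by (rule sum.cong) (simp_all add: A)
  also have "\<dots> = \<pi> $ j * (B ** A) $ j $ i"
    unfolding B[of _ j] by (simp add: matrix_matrix_mult_def sum_distrib_left mult.assoc)
  finally show "\<pi> $ i * (A ** B) $ i $ j = \<pi> $ j * (A ** B) $ j $ i"
    by (simp add: assms)
qed

lemma reversible_matrix_power:
  assumes "reversible_matrix P \<pi>"
  shows "reversible_matrix (matrix_power P k) \<pi>"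
proof (induction k)
  case 0
  then show ?case by (simp add: reversible_matrix_def mat_def)
next
  case (Suc k)
  then show ?case
    using assms matrix_power_Suc_right[of P k] by (simp add: reversible_matrix_mult)
qed

text \<open>\<open>stationary_distribution\<close> contains no sign condition. Since the entries sum
  to 1, one of them is positive, and detailed balance for a power linking that state to
  \<open>j\<close> carries positivity over.\<close>

lemma reversible_irreducible_pos:
  assumes "stochastic_matrix P" "irreducible_matrix P" "stationary_distribution P \<pi>"
    "reversible_matrix P \<pi>"
  shows "0 < \<pi> $ j"
proof -
  obtain i where i: "0 < \<pi> $ i"
  proof -
    have "\<not> (\<forall>i. \<pi> $ i \<le> 0)"
      using assms(3) sum_nonpos[of UNIV "\<lambda>i. \<pi> $ i"] by (auto simp: stationary_distribution_def)
    with that show thesis by (auto simp: not_le)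
  qed
  obtain k where k: "0 < matrix_power P k $ i $ j"
    using assms(2) by (auto simp: irreducible_matrix_def)
  have "\<pi> $ i * matrix_power P k $ i $ j = \<pi> $ j * matrix_power P k $ j $ i"
    using reversible_matrix_power[OF assms(4)] by (auto simp: reversible_matrix_def)
  with i k have "0 < \<pi> $ j * matrix_power P k $ j $ i"
    by (metis mult_pos_pos)
  moreover have "0 \<le> matrix_power P k $ j $ i"
    using stochastic_matrix_power[OF assms(1)] by (auto simp: stochastic_matrix_def)
  ultimately show ?thesis
    by (metis zero_less_mult_pos2 mult_zero_right less_eq_real_def)
qed

text \<open>A variance under \<open>\<pi>\<close>: column \<open>l\<close> has mean
  \<open>\<pi> $ l\<close> by stationarity, and detailed balance turns its second moment into a
  diagonal entry of a power of \<open>P ** P\<close>.\<close>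

lemma weighted_column_variance:
  assumes "stationary_distribution P \<pi>" "reversible_matrix P \<pi>"
  shows "(\<Sum>i\<in>UNIV. \<pi> $ i * (matrix_power P k $ i $ l - \<pi> $ l)\<^sup>2) =
    \<pi> $ l * (matrix_power (P ** P) k $ l $ l - \<pi> $ l)"
proof -
  let ?A = "matrix_power P k"
  have rev: "\<pi> $ i * ?A $ i $ l = \<pi> $ l * ?A $ l $ i" for i
    using reversible_matrix_power[OF assms(2)] by (auto simp: reversible_matrix_def)
  have one: "(\<Sum>i\<in>UNIV. \<pi> $ i) = 1"
    using assms(1) by (simp add: stationary_distribution_def)
  have "\<pi> v* ?A = \<pi>"
    using assms(1) by (intro stationary_matrix_power) (simp add: stationary_distribution_def)
  then have col: "(\<Sum>i\<in>UNIV. \<pi> $ i * ?A $ i $ l) = \<pi> $ l"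
    by (metis (no_types, lifting) vector_matrix_mult_def vec_lambda_beta sum.cong)
  have sq: "(\<Sum>i\<in>UNIV. \<pi> $ i * ?A $ i $ l * ?A $ i $ l) = \<pi> $ l * matrix_power (P ** P) k $ l $ l"
    unfolding rev matrix_power_square
    by (simp add: matrix_matrix_mult_def sum_distrib_left mult.assoc)
  have "(\<Sum>i\<in>UNIV. \<pi> $ i * (?A $ i $ l - \<pi> $ l)\<^sup>2) =
      (\<Sum>i\<in>UNIV. \<pi> $ i * ?A $ i $ l * ?A $ i $ l - 2 * \<pi> $ l * (\<pi> $ i * ?A $ i $ l)
        + (\<pi> $ l)\<^sup>2 * \<pi> $ i)"
    by (intro sum.cong) (auto simp: power2_eq_square algebra_simps)
  also have "\<dots> = \<pi> $ l * matrix_power (P ** P) k $ l $ l - 2 * \<pi> $ l * \<pi> $ l + (\<pi> $ l)\<^sup>2"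
    unfolding sum.distrib sum_subtractf sum_distrib_left[symmetric] sq col one by simp
  finally show ?thesis by (simp add: power2_eq_square algebra_simps)
qed

section \<open>Stationary renewal equation\<close>

text \<open>In \<open>ennreal\<close> the two summations can be exchanged without any convergence
  condition, so divergent series are covered as well.\<close>

lemma ennreal_Cauchy_product:
  fixes b v :: "nat \<Rightarrow> ennreal"
  shows "(\<Sum>n. \<Sum>s\<le>n. b s * v (n - s)) = (\<Sum>s. b s) * (\<Sum>n. v n)"
proof -
  \<comment> \<open>Padding with zeros extends the triangular range to all pairs; for fixed
    \<open>s\<close>, shifting \<open>n\<close> by \<open>s\<close> then leaves the full series of
    \<open>v\<close>.\<close>
  let ?f = "\<lambda>s n. if s \<le> n then b s * v (n - s) else 0"
  have inner: "(\<Sum>n. ?f s n) = b s * (\<Sum>n. v n)" for s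
  proof -
    have "(\<Sum>n. ?f s n) = (\<Sum>n. ?f s (n + s))"
      by (rule suminf_mono_reindex[symmetric])
        (auto simp: strict_mono_def image_iff, metis le_add_diff_inverse2)
    then show ?thesis by simp
  qed
  have "(\<Sum>s\<le>n. b s * v (n - s)) = (\<Sum>s. ?f s n)" for n
    by (subst suminf_finite[of "{..n}"]) auto
  then have "(\<Sum>n. \<Sum>s\<le>n. b s * v (n - s)) = (\<Sum>n. \<Sum>s. ?f s n)" by simp
  also have "\<dots> = (\<integral>\<^sup>+ n. (\<Sum>s. ?f s n) \<partial>count_space UNIV)"
    by (simp add: nn_integral_count_space_nat)
  also have "\<dots> = (\<Sum>s. \<Sum>n. ?f s n)"
    by (subst nn_integral_suminf) (simp_all add: nn_integral_count_space_nat)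
  finally show ?thesis by (simp add: inner)
qed

text \<open>Entry \<open>k\<close> of \<^term>\<open>taboo M j x t\<close> is the probability that the chain started from the
  distribution \<open>x\<close> is at \<open>k\<close> at time \<open>t\<close> without having visited \<open>j\<close> up to then.\<close>

primrec taboo :: "real^'n^'n \<Rightarrow> 'n \<Rightarrow> real^'n \<Rightarrow> nat \<Rightarrow> real^'n" where
  "taboo M j x 0 = (\<chi> k. if k = j then 0 else x $ k)"
| "taboo M j x (Suc t) = (\<chi> k. if k = j then 0 else (taboo M j x t v* M) $ k)"

text \<open>At a positive time this is the entry that \<open>taboo\<close> erases in the same step:
  the mass entering \<open>j\<close> for the first time.\<close>

definition first_visit_mass :: "real^'n^'n \<Rightarrow> 'n \<Rightarrow> real^'n \<Rightarrow> nat \<Rightarrow> real" where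
  "first_visit_mass M j x t = (case t of 0 \<Rightarrow> x $ j | Suc s \<Rightarrow> (taboo M j x s v* M) $ j)"

lemma taboo_nonneg:
  assumes "stochastic_matrix M" "\<And>i. 0 \<le> x $ i"
  shows "0 \<le> taboo M j x t $ k"
  using assms
  by (induction t arbitrary: k)
    (auto simp: vector_matrix_mult_def stochastic_matrix_def intro!: sum_nonneg)

lemma taboo_avoids [simp]: "taboo M j x t $ j = 0"
  by (cases t) auto

lemma first_visit_mass_nonneg:
  assumes "stochastic_matrix M" "\<And>i. 0 \<le> x $ i"
  shows "0 \<le> first_visit_mass M j x t"
  using assms taboo_nonneg[of M x j]
  by (auto simp: first_visit_mass_def vector_matrix_mult_def stochastic_matrix_def
      intro!: sum_nonneg split: nat.split)

lemma sum_vector_stochastic: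
  assumes "stochastic_matrix M"
  shows "(\<Sum>k\<in>UNIV. (x v* M) $ k) = (\<Sum>k\<in>UNIV. x $ k)"
proof -
  have "(\<Sum>k\<in>UNIV. (x v* M) $ k) = (\<Sum>i\<in>UNIV. x $ i * (\<Sum>k\<in>UNIV. M $ i $ k))"
    unfolding sum_distrib_left by (subst sum.swap) (simp add: vector_matrix_mult_def)
  then show ?thesis using assms by (simp add: stochastic_matrix_def)
qed

lemma sum_if_avoid:
  fixes y :: "real^'n"
  shows "(\<Sum>k\<in>UNIV. if k = j then 0 else y $ k) = (\<Sum>k\<in>UNIV. y $ k) - y $ j"
proof -
  have "(\<Sum>k\<in>UNIV. if k = j then 0 else y $ k) = (\<Sum>k\<in>UNIV. y $ k - (if k = j then y $ k else 0))"
    by (rule sum.cong) auto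
  then show ?thesis by (simp add: sum_subtractf)
qed

text \<open>Conservation of mass: a stochastic step preserves the total, so whatever leaves the
  taboo vector is recorded as a first visit.\<close>

lemma sum_first_visit_mass:
  assumes "stochastic_matrix M"
  shows "(\<Sum>s\<le>t. first_visit_mass M j x s) = (\<Sum>k\<in>UNIV. x $ k) - (\<Sum>k\<in>UNIV. taboo M j x t $ k)"
proof (induction t)
  case 0
  then show ?case by (simp add: first_visit_mass_def sum_if_avoid)
next
  case (Suc t)
  then show ?case
    by (simp add: sum_if_avoid sum_vector_stochastic[OF assms])
      (simp add: first_visit_mass_def)
qed

text \<open>Mass is split by the time \<open>s\<close> of its first visit to \<open>j\<close>, after
  which the chain restarts from \<open>j\<close> with \<open>t - s\<close> steps left; the taboo
  term is the mass without such a visit.\<close>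

lemma first_visit_decomposition:
  "x v* matrix_power M t = taboo M j x t +
    (\<Sum>s\<le>t. first_visit_mass M j x s *\<^sub>R (axis j 1 v* matrix_power M (t - s)))"
proof (induction t)
  case 0
  then show ?case
    by (simp add: first_visit_mass_def vec_eq_iff axis_def)
next
  case (Suc t)
  let ?b = "first_visit_mass M j x"
  \<comment> \<open>One step yields the new survivors plus the mass just arriving at
    \<open>j\<close>, which becomes the summand \<open>s = Suc t\<close> with no steps left.\<close>
  have step: "taboo M j x t v* M = taboo M j x (Suc t) + ?b (Suc t) *\<^sub>R axis j 1"
    by (simp add: first_visit_mass_def vec_eq_iff axis_def)
  have lin: "(\<Sum>s\<in>A. ?b s *\<^sub>R y s) v* M = (\<Sum>s\<in>A. ?b s *\<^sub>R (y s v* M))"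
    if "finite A" for A :: "nat set" and y :: "nat \<Rightarrow> real^'a"
    using that
    by (induction) (simp_all add: vector_matrix_left_distrib scaleR_vector_matrix_assoc)
  have "x v* matrix_power M (Suc t) = (x v* matrix_power M t) v* M"
    unfolding matrix_power_Suc_right vector_matrix_mul_assoc ..
  also have "\<dots> = taboo M j x t v* M +
      (\<Sum>s\<le>t. ?b s *\<^sub>R (axis j 1 v* matrix_power M (Suc (t - s))))"
    unfolding Suc vector_matrix_left_distrib lin[OF finite_atMost]
    by (simp only: matrix_power_Suc_right vector_matrix_mul_assoc)
  also have "\<dots> = taboo M j x (Suc t) +
      (\<Sum>s\<le>Suc t. ?b s *\<^sub>R (axis j 1 v* matrix_power M (Suc t - s)))"
    unfolding step by (simp add: Suc_diff_le del: taboo.simps matrix_power.simps(2))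
  finally show ?case .
qed

lemma axis_vector_matrix: "(axis j 1 v* M) $ k = (M $ j $ k :: real)"
  by (simp add: vector_matrix_mult_def axis_def if_distrib[of "\<lambda>x. x * _"] cong: if_cong)

text \<open>Summing the decomposition of \<open>\<pi>\<close> at its first visit to \<open>j\<close> gives a convolution identity
  between the first-visit masses and the excess return probabilities. When the masses do not add
  up to 1, or the waiting time is not integrable, both sides are infinite.\<close>

lemma stationary_return_excess:
  fixes M :: "real^'n^'n"
  assumes M: "stochastic_matrix M" and \<pi>: "\<pi> v* M = \<pi>" "(\<Sum>i\<in>UNIV. \<pi> $ i) = 1"
    and pos: "\<And>i. 0 < \<pi> $ i"
    and excess: "\<And>k. \<pi> $ j \<le> matrix_power M k $ j $ j"
  shows "(\<Sum>k. ennreal (matrix_power M k $ j $ j - \<pi> $ j)) =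
    ennreal (\<pi> $ j) * (\<Sum>t. ennreal (\<Sum>k\<in>UNIV. taboo M j \<pi> t $ k))"
proof -
  define a where "a t = (\<Sum>k\<in>UNIV. taboo M j \<pi> t $ k)" for t
  define b where "b = first_visit_mass M j \<pi>"
  define v where "v k = matrix_power M k $ j $ j - \<pi> $ j" for k
  have a0: "0 \<le> a t" for t
    unfolding a_def by (intro sum_nonneg taboo_nonneg[OF M] less_imp_le pos)
  have b0: "0 \<le> b t" for t
    unfolding b_def by (intro first_visit_mass_nonneg[OF M] less_imp_le pos)
  have v0: "0 \<le> v k" for k using excess by (simp add: v_def)
  have sum_b: "(\<Sum>s\<le>t. b s) = 1 - a t" for t
    by (simp add: a_def b_def sum_first_visit_mass[OF M] \<pi>)
  have "\<pi> = taboo M j \<pi> t + (\<Sum>s\<le>t. b s *\<^sub>R (axis j 1 v* matrix_power M (t - s)))" for t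
    using first_visit_decomposition[of \<pi> M t j] stationary_matrix_power[OF \<pi>(1), of t]
    by (simp add: b_def)
  then have "\<pi> $ j = (taboo M j \<pi> t + (\<Sum>s\<le>t. b s *\<^sub>R (axis j 1 v* matrix_power M (t - s)))) $ j" for t
    by metis
  then have "\<pi> $ j = (\<Sum>s\<le>t. b s * matrix_power M (t - s) $ j $ j)" for t
    by (simp add: axis_vector_matrix)
  \<comment> \<open>Subtracting \<open>\<pi> $ j\<close> from every return probability removes
    \<open>\<pi> $ j * (1 - a t)\<close>, since the masses up to \<open>t\<close> add up to
    \<open>1 - a t\<close>.\<close>
  then have conv: "(\<Sum>s\<le>t. b s * v (t - s)) = \<pi> $ j * a t" for t
    using sum_b[of t]
    by (simp add: v_def right_diff_distrib sum_subtractf flip: sum_distrib_right)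
      (simp add: algebra_simps)
  have "(\<Sum>s. ennreal (b s)) * (\<Sum>n. ennreal (v n)) = (\<Sum>t. \<Sum>s\<le>t. ennreal (b s) * ennreal (v (t - s)))"
    by (rule ennreal_Cauchy_product[symmetric])
  also have "\<dots> = (\<Sum>t. ennreal (\<pi> $ j * a t))"
    unfolding conv[symmetric] by (simp add: b0 v0 ennreal_mult flip: sum_ennreal)
  also have "\<dots> = ennreal (\<pi> $ j) * (\<Sum>t. ennreal (a t))"
    by (simp add: ennreal_mult a0 less_imp_le[OF pos])
  finally have prod: "(\<Sum>s. ennreal (b s)) * (\<Sum>n. ennreal (v n)) = ennreal (\<pi> $ j) * (\<Sum>t. ennreal (a t))" .
  have sum_b_le: "(\<Sum>s. ennreal (b s)) \<le> 1"
  proof (rule suminf_le_const[OF summableI])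
    fix n
    have "(\<Sum>s<n. b s) \<le> 1"
      using sum_b[of n] a0[of n] b0[of n] by (simp add: lessThan_Suc_atMost[symmetric])
    then show "(\<Sum>s<n. ennreal (b s)) \<le> 1"
      by (simp add: b0 sum_ennreal)
  qed
  show ?thesis
  proof (cases "(\<Sum>t. ennreal (a t)) = \<top>")
    case True
    then have "(\<Sum>s. ennreal (b s)) * (\<Sum>n. ennreal (v n)) = \<top>"
      unfolding prod using pos[of j] by (simp add: ennreal_mult_eq_top_iff not_le)
    moreover have "(\<Sum>s. ennreal (b s)) \<noteq> \<top>"
      using sum_b_le by (auto simp: top_unique)
    ultimately have "(\<Sum>n. ennreal (v n)) = \<top>"
      by (simp add: ennreal_mult_eq_top_iff)
    then show ?thesis
      using True pos[of j] by (simp add: v_def a_def ennreal_mult_eq_top_iff not_le)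
  next
    case False
    \<comment> \<open>A convergent survival series forces \<open>a\<close> to 0, so the first-visit
      masses total exactly 1 and drop out of the product.\<close>
    then have "summable a"
      by (rule summable_suminf_not_top[OF a0])
    then have "a \<longlonglongrightarrow> 0" by (rule summable_LIMSEQ_zero)
    then have "(\<lambda>t. 1 - a t) \<longlonglongrightarrow> 1 - 0" by (intro tendsto_intros)
    then have "(\<lambda>t. \<Sum>s\<le>t. b s) \<longlonglongrightarrow> 1" by (simp add: sum_b)
    then have "b sums 1" by (simp add: sums_def_le)
    then have "(\<Sum>s. ennreal (b s)) = 1"
      using suminf_ennreal_eq[OF b0] by simp
    with prod show ?thesis by (simp add: v_def a_def)
  qed
qed

section \<open>Hitting times as sums of taboo probabilities\<close>

lemma taboo_linear:
  "(\<Sum>i\<in>UNIV. y $ i * taboo M j (axis i 1) t $ k) = taboo M j y t $ k"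
proof (induction t arbitrary: k)
  case 0
  then show ?case by (simp add: axis_def if_distrib[of "\<lambda>x. _ * x"] cong: if_cong)
next
  case (Suc t)
  have "(\<Sum>i\<in>UNIV. y $ i * (taboo M j (axis i 1) t v* M) $ k) =
      (\<Sum>l\<in>UNIV. (\<Sum>i\<in>UNIV. y $ i * taboo M j (axis i 1) t $ l) * M $ l $ k)"
    unfolding vector_matrix_mult_def sum_distrib_right
    by (subst sum.swap) (simp add: sum_distrib_left mult.assoc)
  then show ?case by (simp add: Suc) (simp add: vector_matrix_mult_def)
qed

text \<open>The Markov property for paths confined to \<open>A\<close>, reduced to probabilities of
  fixed finite paths: the event is a finite disjoint union of cylinders, and lengthening each by
  \<open>k\<close> multiplies its measure by the same entry of \<open>M\<close>.\<close>

lemma emeasure_markov_chain_step: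
  fixes M :: "real^'n^'n"
  assumes M: "stochastic_matrix M"
  shows "emeasure (markov_chain M i) {w. (\<forall>s\<le>t. w s \<in> A) \<and> w t = l \<and> w (Suc t) = k} =
    emeasure (markov_chain M i) {w. (\<forall>s\<le>t. w s \<in> A) \<and> w t = l} * ennreal (M $ l $ k)"
proof -
  let ?C = "\<lambda>t a. {w :: nat \<Rightarrow> 'n. \<forall>s\<le>t. w s = a s}"
  \<comment> \<open>Prefixes are extensional functions on \<open>{..t}\<close>, so there are
    finitely many and each path has exactly one.\<close>
  define F where "F = {a \<in> {..t} \<rightarrow>\<^sub>E A. a t = l}"
  have finF: "finite F"
    unfolding F_def by (rule finite_subset[OF _ finite_PiE[of "{..t}" "\<lambda>_. A"]]) auto
  have sets: "?C t a \<in> sets (markov_chain M i)" for t a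
  proof -
    have "?C t a = {w \<in> space (PiM UNIV (\<lambda>_. count_space UNIV)). \<forall>s\<in>{..t}. w s = a s}"
      by (auto simp: space_PiM)
    also have "\<dots> \<in> sets (PiM UNIV (\<lambda>_. count_space UNIV))" by measurable
    finally show ?thesis by (simp add: sets_markov_chain[OF M])
  qed
  have uniq: "a = b" if "a \<in> F" "b \<in> F" "\<forall>s\<le>t. a s = b s" for a b
    using that by (intro PiE_ext[of a "{..t}" "\<lambda>_. A" b]) (auto simp: F_def)
  have cover: "restrict w {..t} \<in> F" if "\<forall>s\<le>t. w s \<in> A" "w t = l" for w
    using that by (auto simp: F_def)
  have inA: "a s \<in> A" if "a \<in> F" "s \<le> t" for a s
    using that by (auto simp: F_def)
  have at: "a t = l" if "a \<in> F" for a
    using that by (auto simp: F_def)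
  have E1: "{w. (\<forall>s\<le>t. w s \<in> A) \<and> w t = l} = (\<Union>a\<in>F. ?C t a)"
  proof (intro set_eqI iffI)
    fix w assume "w \<in> {w. (\<forall>s\<le>t. w s \<in> A) \<and> w t = l}"
    then show "w \<in> (\<Union>a\<in>F. ?C t a)"
      using cover[of w] by (intro UN_I[of "restrict w {..t}"]) auto
  qed (use inA at in auto)
  have E2: "{w. (\<forall>s\<le>t. w s \<in> A) \<and> w t = l \<and> w (Suc t) = k} = (\<Union>a\<in>F. ?C (Suc t) (a(Suc t := k)))"
  proof (intro set_eqI iffI)
    fix w assume "w \<in> {w. (\<forall>s\<le>t. w s \<in> A) \<and> w t = l \<and> w (Suc t) = k}"
    then have w: "restrict w {..t} \<in> F" "w (Suc t) = k" using cover by auto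
    have "w s = ((restrict w {..t})(Suc t := k)) s" if "s \<le> Suc t" for s
      using that w(2) by (cases "s = Suc t") simp_all
    then show "w \<in> (\<Union>a\<in>F. ?C (Suc t) (a(Suc t := k)))"
      by (intro UN_I[OF w(1)] CollectI) blast
  next
    fix w assume "w \<in> (\<Union>a\<in>F. ?C (Suc t) (a(Suc t := k)))"
    then obtain a where a: "a \<in> F" "\<And>s. s \<le> Suc t \<Longrightarrow> w s = (a(Suc t := k)) s" by auto
    have "w s = a s" if "s \<le> t" for s using a(2)[of s] that by simp
    then show "w \<in> {w. (\<forall>s\<le>t. w s \<in> A) \<and> w t = l \<and> w (Suc t) = k}"
      using a(1) a(2)[of "Suc t"] inA at by simp
  qed
  have d1: "disjoint_family_on (\<lambda>a. ?C t a) F"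
  unfolding disjoint_family_on_def
  proof (intro ballI impI)
    fix a b assume "a \<in> F" "b \<in> F" "a \<noteq> b"
    then obtain s where s: "s \<le> t" "a s \<noteq> b s" using uniq by blast
    show "?C t a \<inter> ?C t b = {}"
    proof (rule equals0I)
      fix w assume "w \<in> ?C t a \<inter> ?C t b"
      then have "w s = a s" "w s = b s" using s by auto
      with s show False by simp
    qed
  qed
  have d2: "disjoint_family_on (\<lambda>a. ?C (Suc t) (a(Suc t := k))) F"
  unfolding disjoint_family_on_def
  proof (intro ballI impI)
    fix a b assume "a \<in> F" "b \<in> F" "a \<noteq> b"
    then obtain s where s: "s \<le> t" "a s \<noteq> b s" using uniq by blast
    show "?C (Suc t) (a(Suc t := k)) \<inter> ?C (Suc t) (b(Suc t := k)) = {}"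
    proof (rule equals0I)
      fix w assume "w \<in> ?C (Suc t) (a(Suc t := k)) \<inter> ?C (Suc t) (b(Suc t := k))"
      then have "w s = (a(Suc t := k)) s" "w s = (b(Suc t := k)) s"
        using le_SucI[OF s(1)] by blast+
      with s show False by simp
    qed
  qed
  have step: "emeasure (markov_chain M i) (?C (Suc t) (a(Suc t := k))) =
      emeasure (markov_chain M i) (?C t a) * ennreal (M $ l $ k)" if "a \<in> F" for a
  proof -
    have "(\<Prod>s<t. M $ (a(Suc t := k)) s $ (a(Suc t := k)) (Suc s)) = (\<Prod>s<t. M $ a s $ a (Suc s))"
      by (rule prod.cong) auto
    moreover have "0 \<le> (\<Prod>s<t. M $ a s $ a (Suc s))" "0 \<le> M $ l $ k"
      using M by (auto intro!: prod_nonneg simp: stochastic_matrix_def)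
    ultimately show ?thesis
      unfolding emeasure_markov_chain[OF M] by (simp add: at[OF that] ennreal_mult)
  qed
  have "emeasure (markov_chain M i) (\<Union>a\<in>F. ?C (Suc t) (a(Suc t := k))) =
      (\<Sum>a\<in>F. emeasure (markov_chain M i) (?C (Suc t) (a(Suc t := k))))"
    by (rule sum_emeasure[symmetric, OF _ d2 finF]) (use sets in blast)
  also have "\<dots> = (\<Sum>a\<in>F. emeasure (markov_chain M i) (?C t a)) * ennreal (M $ l $ k)"
    unfolding sum_distrib_right by (rule sum.cong[OF refl step])
  also have "(\<Sum>a\<in>F. emeasure (markov_chain M i) (?C t a)) =
      emeasure (markov_chain M i) (\<Union>a\<in>F. ?C t a)"
    by (rule sum_emeasure[OF _ d1 finF]) (use sets in blast)
  finally show ?thesis unfolding E1 E2 .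
qed

text \<open>This ties the vector recursion to the path measure. The induction splits by the state
  \<open>l\<close> at time \<open>t\<close> and applies the Markov step with \<open>A\<close> the
  complement of \<open>j\<close>.\<close>

lemma emeasure_taboo:
  fixes M :: "real^'n^'n"
  assumes M: "stochastic_matrix M"
  shows "emeasure (markov_chain M i) {w. (\<forall>s\<le>t. w s \<noteq> j) \<and> w t = k} =
    ennreal (taboo M j (axis i 1) t $ k)"
proof (induction t arbitrary: k)
  case 0
  have "emeasure (markov_chain M i) {w. w 0 = k} = (if k = i then 1 else 0)"
    using emeasure_markov_chain[OF M, of i 0 "\<lambda>_. k"] by simp
  moreover have "{w :: nat \<Rightarrow> 'n. (\<forall>s\<le>0. w s \<noteq> j) \<and> w 0 = k} =
      (if k = j then {} else {w. w 0 = k})"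
    by auto
  ultimately show ?case by (simp add: axis_def)
next
  case (Suc t)
  let ?x = "taboo M j (axis i 1)"
  show ?case
  proof (cases "k = j")
    case True
    then have empty: "{w. (\<forall>s\<le>Suc t. w s \<noteq> j) \<and> w (Suc t) = k} = {}" by auto
    show ?thesis unfolding empty using True by simp
  next
    case False
    let ?E = "\<lambda>l. {w. (\<forall>s\<le>t. w s \<in> - {j}) \<and> w t = l \<and> w (Suc t) = k}"
    have sets: "?E l \<in> sets (markov_chain M i)" for l
    proof -
      have "?E l = {w \<in> space (PiM UNIV (\<lambda>_. count_space UNIV)).
          (\<forall>s\<in>{..t}. w s \<in> - {j}) \<and> w t = l \<and> w (Suc t) = k}"
        by (auto simp: space_PiM)
      also have "\<dots> \<in> sets (PiM UNIV (\<lambda>_. count_space UNIV))" by measurable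
      finally show ?thesis by (simp add: sets_markov_chain[OF M])
    qed
    have x0: "0 \<le> ?x t $ l" for l
      by (rule taboo_nonneg[OF M]) (simp add: axis_def)
    have "{w. (\<forall>s\<le>Suc t. w s \<noteq> j) \<and> w (Suc t) = k} = (\<Union>l\<in>UNIV. ?E l)"
      using False by (auto simp: le_Suc_eq)
    then have "emeasure (markov_chain M i) {w. (\<forall>s\<le>Suc t. w s \<noteq> j) \<and> w (Suc t) = k} =
        (\<Sum>l\<in>UNIV. emeasure (markov_chain M i) (?E l))"
      by (simp only:) (rule sum_emeasure[symmetric]; use sets in \<open>auto simp: disjoint_family_on_def\<close>)
    also have "\<dots> = (\<Sum>l\<in>UNIV. ennreal (?x t $ l) * ennreal (M $ l $ k))"
      unfolding emeasure_markov_chain_step[OF M] by (simp add: Suc)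
    also have "\<dots> = (\<Sum>l\<in>UNIV. ennreal (?x t $ l * M $ l $ k))"
      using M x0 by (simp add: ennreal_mult stochastic_matrix_def)
    also have "\<dots> = ennreal (\<Sum>l\<in>UNIV. ?x t $ l * M $ l $ k)"
      using M x0 by (intro sum_ennreal) (simp add: stochastic_matrix_def)
    finally show ?thesis using False by (simp add: vector_matrix_mult_def)
  qed
qed

text \<open>Tail-sum formula: a first visit at time \<open>T\<close> is preceded by exactly
  \<open>T\<close> times, each contributing 1; without a visit every time contributes and the sum is
  infinite.\<close>

lemma first_visit_eq_suminf:
  "first_visit j w = (\<Sum>t. indicator {w. \<forall>s\<le>t. w s \<noteq> j} w)"
proof (cases "\<exists>t. w t = j")
  case True
  define T where "T = (LEAST t. w t = j)"
  have T: "w T = j" unfolding T_def using True by (rule LeastI_ex)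
  have T_le: "T \<le> t" if "w t = j" for t unfolding T_def using that by (rule Least_le)
  have "first_visit j w = of_nat T"
    unfolding first_visit_def using T T_le
    by (intro antisym INF_lower INF_greatest) auto
  moreover have "(\<forall>s\<le>t. w s \<noteq> j) \<longleftrightarrow> t < T" for t
    using T T_le by (metis leD leI le_trans)
  then have "(\<Sum>t. indicator {w. \<forall>s\<le>t. w s \<noteq> j} w) = (\<Sum>t\<in>{..<T}. (1::ennreal))"
    by (subst suminf_finite[of "{..<T}"]) (auto simp: indicator_def)
  ultimately show ?thesis by simp
next
  case False
  then have "first_visit j w = \<top>" by (simp add: first_visit_def)
  moreover have "(\<Sum>t. indicator {w. \<forall>s\<le>t. w s \<noteq> j} w) = (\<Sum>t::nat. (1::ennreal))"
    using False by (simp add: indicator_def)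
  moreover have "(\<Sum>t::nat. (1::ennreal)) = \<top>"
    by (simp flip: nn_integral_count_space_nat)
  ultimately show ?thesis by simp
qed

text \<open>The tail-sum formula is integrated term by term, and avoidance of \<open>j\<close> up to
  time \<open>t\<close> is split by the position at that time.\<close>

lemma hitting_time_eq_suminf_taboo:
  fixes M :: "real^'n^'n"
  assumes M: "stochastic_matrix M"
  shows "hitting_time M i j = (\<Sum>t. \<Sum>k\<in>UNIV. ennreal (taboo M j (axis i 1) t $ k))"
proof -
  have sets: "{w. (\<forall>s\<le>t. w s \<noteq> j) \<and> w t = k} \<in> sets (markov_chain M i)" for t k
  proof -
    have "{w. (\<forall>s\<le>t. w s \<noteq> j) \<and> w t = k} = {w \<in> space (PiM UNIV (\<lambda>_. count_space UNIV)).
        (\<forall>s\<in>{..t}. w s \<noteq> j) \<and> w t = k}"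
      by (auto simp: space_PiM)
    also have "\<dots> \<in> sets (PiM UNIV (\<lambda>_. count_space UNIV))" by measurable
    finally show ?thesis by (simp add: sets_markov_chain[OF M])
  qed
  have un: "{w. \<forall>s\<le>t. w s \<noteq> j} = (\<Union>k\<in>UNIV. {w. (\<forall>s\<le>t. w s \<noteq> j) \<and> w t = k})" for t
    by auto
  have sets': "{w. \<forall>s\<le>t. w s \<noteq> j} \<in> sets (markov_chain M i)" for t
    unfolding un by (intro sets.finite_UN finite sets)
  have "emeasure (markov_chain M i) {w. \<forall>s\<le>t. w s \<noteq> j} =
      (\<Sum>k\<in>UNIV. ennreal (taboo M j (axis i 1) t $ k))" for t
    unfolding un emeasure_taboo[OF M, symmetric]
    by (rule sum_emeasure[symmetric]) (use sets in \<open>auto simp: disjoint_family_on_def\<close>)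
  then show ?thesis
    unfolding hitting_time_def first_visit_eq_suminf
    by (subst nn_integral_suminf) (use sets' in auto)
qed

text \<open>Taken at \<open>y = \<pi>\<close>, this identifies the stationary average of hitting
  times with the survival series of the renewal identity.\<close>

lemma sum_weighted_hitting_time:
  fixes M :: "real^'n^'n"
  assumes M: "stochastic_matrix M" and y: "\<And>i. 0 \<le> y $ i"
  shows "(\<Sum>i\<in>UNIV. ennreal (y $ i) * hitting_time M i j) =
    (\<Sum>t. ennreal (\<Sum>k\<in>UNIV. taboo M j y t $ k))"
proof -
  have x0: "0 \<le> taboo M j (axis i 1) t $ k" for i t k
    by (rule taboo_nonneg[OF M]) (simp add: axis_def)
  have "(\<Sum>i\<in>UNIV. ennreal (y $ i) * hitting_time M i j) =
      (\<Sum>i\<in>UNIV. \<Sum>t. ennreal (\<Sum>k\<in>UNIV. y $ i * taboo M j (axis i 1) t $ k))"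
  proof (rule sum.cong[OF refl])
    fix i
    have "(\<Sum>k\<in>UNIV. ennreal (y $ i) * ennreal (taboo M j (axis i 1) t $ k)) =
        ennreal (\<Sum>k\<in>UNIV. y $ i * taboo M j (axis i 1) t $ k)" for t
      by (subst sum_ennreal[symmetric]) (simp_all add: x0 y ennreal_mult)
    then show "ennreal (y $ i) * hitting_time M i j =
        (\<Sum>t. ennreal (\<Sum>k\<in>UNIV. y $ i * taboo M j (axis i 1) t $ k))"
      unfolding hitting_time_eq_suminf_taboo[OF M] ennreal_suminf_cmult[symmetric]
      by (simp only: sum_distrib_left)
  qed
  also have "\<dots> = (\<Sum>t. \<Sum>i\<in>UNIV. ennreal (\<Sum>k\<in>UNIV. y $ i * taboo M j (axis i 1) t $ k))"
    by (intro suminf_sum[symmetric] summableI)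
  also have "\<dots> = (\<Sum>t. ennreal (\<Sum>i\<in>UNIV. \<Sum>k\<in>UNIV. y $ i * taboo M j (axis i 1) t $ k))"
    by (simp add: x0 y sum_nonneg)
  also have "\<dots> = (\<Sum>t. ennreal (\<Sum>k\<in>UNIV. taboo M j y t $ k))"
    by (subst sum.swap) (simp add: taboo_linear)
  finally show ?thesis .
qed

section \<open>Second moments of the consensus error\<close>

text \<open>At equal times this is a covariance entry; at different times independence factors the
  expectation into two zero means.\<close>

lemma iid_noise_moments:
  fixes w :: "nat \<Rightarrow> 'a \<Rightarrow> real^'n"
  assumes noise: "iid_noise \<Omega> w S"
  shows "has_bochner_integral \<Omega> (\<lambda>\<omega>. w s \<omega> $ l * w t \<omega> $ m) (if s = t then S $ l $ m else 0)"
proof (cases "s = t")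
  case True
  have "has_bochner_integral \<Omega> (\<lambda>\<omega>. \<chi> i j. w t \<omega> $ i * w t \<omega> $ j) S"
    using noise unfolding iid_noise_def by blast
  then have "has_bochner_integral \<Omega> (\<lambda>\<omega>. (\<chi> i j. w t \<omega> $ i * w t \<omega> $ j) $ l $ m) (S $ l $ m)"
    by (intro has_bochner_integral_bounded_linear[OF bounded_linear_vec_nth])
  with True show ?thesis by simp
next
  case False
  interpret prob_space \<Omega> using noise unfolding iid_noise_def by blast
  \<comment> \<open>The coordinate depends on the time index so that a single independent family
    over \<open>{s, t}\<close> contains both factors.\<close>
  let ?Y = "\<lambda>r x. x $ (if r = s then l else m)"
  have zero: "has_bochner_integral \<Omega> (\<lambda>\<omega>. ?Y r (w r \<omega>)) 0" for r
  proof -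
    have "has_bochner_integral \<Omega> (w r) 0" using noise unfolding iid_noise_def by blast
    then have "has_bochner_integral \<Omega> (\<lambda>\<omega>. ?Y r (w r \<omega>)) ((0 :: real^'n) $ (if r = s then l else m))"
      by (rule has_bochner_integral_bounded_linear[OF bounded_linear_vec_nth])
    then show ?thesis by simp
  qed
  have "indep_vars (\<lambda>_. borel) w {s, t}"
    using noise unfolding iid_noise_def by (blast intro: indep_vars_subset)
  then have ind: "indep_vars (\<lambda>_. borel) (\<lambda>r \<omega>. ?Y r (w r \<omega>)) {s, t}"
    by (rule indep_vars_compose2) simp
  from zero False show ?thesis
    using indep_vars_integrable[OF _ ind] indep_vars_lebesgue_integral[OF _ ind]
    by (simp add: has_bochner_integral_iff)
qed

text \<open>Noise \<open>w s\<close> enters the state at time \<open>Suc s\<close>, which leaves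
  \<open>t - Suc s\<close> applications of \<open>P\<close>; the zero start contributes
  nothing.\<close>

lemma consensus_eq_sum:
  "consensus P w t \<omega> = (\<Sum>s<t. matrix_power P (t - Suc s) *v w s \<omega>)"
proof (induction t)
  case (Suc t)
  have "P *v (\<Sum>s<t. matrix_power P (t - Suc s) *v w s \<omega>) =
      (\<Sum>s<t. matrix_power P (Suc t - Suc s) *v w s \<omega>)"
    by (simp add: Suc_diff_Suc linear_sum[OF matrix_vector_mul_linear] matrix_vector_mul_assoc
        flip: matrix_power.simps(2))
  then show ?case using Suc by simp
qed simp

text \<open>By stationarity each past noise contributes \<open>\<pi> \<bullet> w s \<omega>\<close>
  to the weighted average whatever its age, so each row entry is replaced by its deviation from
  \<open>\<pi>\<close>.\<close>

lemma consensus_error_eq_sum: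
  fixes P :: "real^'n^'n"
  assumes "\<pi> v* P = \<pi>"
  shows "consensus_error P \<pi> w t \<omega> $ i =
    (\<Sum>(s, l)\<in>{..<t} \<times> UNIV. (matrix_power P (t - Suc s) $ i $ l - \<pi> $ l) * w s \<omega> $ l)"
proof -
  have "(\<Sum>i\<in>UNIV. \<pi> $ i * consensus P w t \<omega> $ i) = (\<pi> \<bullet> consensus P w t \<omega>)"
    by (simp add: inner_vec_def)
  also have "\<dots> = (\<Sum>s<t. \<pi> \<bullet> w s \<omega>)"
    unfolding consensus_eq_sum inner_sum_right dot_lmul_matrix[symmetric]
    by (simp add: stationary_matrix_power[OF assms])
  finally have "consensus_error P \<pi> w t \<omega> $ i =
      (\<Sum>s<t. (matrix_power P (t - Suc s) *v w s \<omega>) $ i - \<pi> \<bullet> w s \<omega>)"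
    by (simp add: consensus_error_def weighted_average_def consensus_eq_sum sum_subtractf)
  also have "\<dots> = (\<Sum>s<t. \<Sum>l\<in>UNIV. (matrix_power P (t - Suc s) $ i $ l - \<pi> $ l) * w s \<omega> $ l)"
    by (simp add: matrix_vector_mult_def inner_vec_def sum_subtractf left_diff_distrib)
  finally show ?thesis by (simp add: sum.cartesian_product)
qed

text \<open>Squaring gives a double sum over pairs of time and coordinate; uncorrelated times and a
  diagonal covariance leave only its diagonal.\<close>

lemma nn_integral_consensus_error:
  fixes P :: "real^'n^'n"
  assumes noise: "iid_noise \<Omega> w (diagonal_matrix d)" and st: "\<pi> v* P = \<pi>"
  shows "(\<integral>\<^sup>+ \<omega>. ennreal ((consensus_error P \<pi> w t \<omega> $ i)\<^sup>2) \<partial>\<Omega>) =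
    ennreal (\<Sum>k<t. \<Sum>l\<in>UNIV. d l * (matrix_power P k $ i $ l - \<pi> $ l)\<^sup>2)"
proof -
  define c where "c = (\<lambda>(s, l). matrix_power P (t - Suc s) $ i $ l - \<pi> $ l)"
  define x where "x = (\<lambda>(s, l) \<omega>. w s \<omega> $ l)"
  let ?I = "{..<t} \<times> (UNIV :: 'n set)"
  have err: "consensus_error P \<pi> w t \<omega> $ i = (\<Sum>p\<in>?I. c p * x p \<omega>)" for \<omega>
    by (simp add: consensus_error_eq_sum[OF st] c_def x_def case_prod_unfold)
  have mom: "has_bochner_integral \<Omega> (\<lambda>\<omega>. x p \<omega> * x q \<omega>) (if p = q then d (snd p) else 0)" for p q
    using iid_noise_moments[OF noise, of "fst p" "snd p" "fst q" "snd q"]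
    by (simp add: x_def case_prod_unfold prod_eq_iff diagonal_matrix_def split: if_splits)
  have "has_bochner_integral \<Omega> (\<lambda>\<omega>. \<Sum>p\<in>?I. \<Sum>q\<in>?I. c p * c q * (x p \<omega> * x q \<omega>))
      (\<Sum>p\<in>?I. \<Sum>q\<in>?I. c p * c q * (if p = q then d (snd p) else 0))"
    by (intro has_bochner_integral_sum has_bochner_integral_mult_right mom)
  moreover have "(\<lambda>\<omega>. \<Sum>p\<in>?I. \<Sum>q\<in>?I. c p * c q * (x p \<omega> * x q \<omega>)) =
      (\<lambda>\<omega>. (consensus_error P \<pi> w t \<omega> $ i)\<^sup>2)"
    unfolding err power2_eq_square sum_product by (intro ext sum.cong) auto
  moreover have "(\<Sum>p\<in>?I. \<Sum>q\<in>?I. c p * c q * (if p = q then d (snd p) else 0)) =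
      (\<Sum>k<t. \<Sum>l\<in>UNIV. d l * (matrix_power P k $ i $ l - \<pi> $ l)\<^sup>2)"
  proof -
    have "(\<Sum>p\<in>?I. \<Sum>q\<in>?I. c p * c q * (if p = q then d (snd p) else 0)) =
        (\<Sum>p\<in>?I. d (snd p) * (c p)\<^sup>2)"
      by (intro sum.cong) (auto simp: if_distrib[of "\<lambda>x. _ * x"] power2_eq_square cong: if_cong)
    also have "\<dots> = (\<Sum>s<t. \<Sum>l\<in>UNIV. d l * (matrix_power P (t - Suc s) $ i $ l - \<pi> $ l)\<^sup>2)"
      by (simp add: sum.cartesian_product c_def case_prod_unfold)
    \<comment> \<open>Indexing by the age \<open>k\<close> of the noise gives a partial sum whose
      terms do not depend on \<open>t\<close>.\<close>
    also have "\<dots> = (\<Sum>k<t. \<Sum>l\<in>UNIV. d l * (matrix_power P k $ i $ l - \<pi> $ l)\<^sup>2)"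
      by (rule sum.nat_diff_reindex)
    finally show ?thesis .
  qed
  ultimately have sq: "has_bochner_integral \<Omega> (\<lambda>\<omega>. (consensus_error P \<pi> w t \<omega> $ i)\<^sup>2)
      (\<Sum>k<t. \<Sum>l\<in>UNIV. d l * (matrix_power P k $ i $ l - \<pi> $ l)\<^sup>2)"
    by (simp only:)
  show ?thesis
    unfolding has_bochner_integral_integral_eq[OF sq, symmetric]
    by (rule nn_integral_eq_integral[OF integrable.intros[OF sq]]) simp
qed

section \<open>Comparison with the weighted disagreement\<close>

theorem mainTheorem3:
  fixes P :: "real^'n^'n" and \<pi> :: "real^'n" and \<sigma> :: "'n \<Rightarrow> real"
    and \<Omega> :: "'a measure" and w :: "nat \<Rightarrow> 'a \<Rightarrow> real^'n"
  assumes "stochastic_matrix P" and "irreducible_matrix P" and "aperiodic_matrix P"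
    and "stationary_distribution P \<pi>" and "reversible_matrix P \<pi>"
    and "iid_noise \<Omega> w (diagonal_matrix (\<lambda>i. (\<sigma> i)\<^sup>2))"
  shows "ennreal (1 / (real CARD('n) * (MAX i. \<pi> $ i))) *
           (\<Sum>i\<in>UNIV. \<Sum>j\<in>UNIV. ennreal ((\<sigma> i)\<^sup>2 * (\<pi> $ i)\<^sup>2 * \<pi> $ j) * hitting_time (P ** P) j i)
         \<le> steady_state_disagreement \<Omega> P \<pi> w
       \<and> steady_state_disagreement \<Omega> P \<pi> w
         \<le> ennreal (1 / (real CARD('n) * (MIN i. \<pi> $ i))) *
           (\<Sum>i\<in>UNIV. \<Sum>j\<in>UNIV. ennreal ((\<sigma> i)\<^sup>2 * (\<pi> $ i)\<^sup>2 * \<pi> $ j) * hitting_time (P ** P) j i)"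
proof -
  let ?n = "real CARD('n)" and ?max = "MAX i. \<pi> $ i" and ?min = "MIN i. \<pi> $ i"
  let ?R = "\<Sum>i\<in>UNIV. \<Sum>j\<in>UNIV. ennreal ((\<sigma> i)\<^sup>2 * (\<pi> $ i)\<^sup>2 * \<pi> $ j) * hitting_time (P ** P) j i"
  have pos: "0 < \<pi> $ i" for i
    using assms by (intro reversible_irreducible_pos)
  have st: "\<pi> v* P = \<pi>" "(\<Sum>i\<in>UNIV. \<pi> $ i) = 1"
    using assms(4) by (auto simp: stationary_distribution_def)
  have Q: "stochastic_matrix (P ** P)" using assms(1) by (intro stochastic_matrix_mult)
  have stQ: "\<pi> v* (P ** P) = \<pi>" by (simp add: st flip: vector_matrix_mul_assoc)
  have max: "\<pi> $ i \<le> ?max" and min: "?min \<le> \<pi> $ i" for i by auto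
  have max_pos: "0 < ?max" using pos[of undefined] max[of undefined] by linarith
  have min_pos: "0 < ?min" using pos by (subst Min_gr_iff) auto

  define v where "v l k = matrix_power (P ** P) k $ l $ l - \<pi> $ l" for l k
  have var: "(\<Sum>i\<in>UNIV. \<pi> $ i * (matrix_power P k $ i $ l - \<pi> $ l)\<^sup>2) = \<pi> $ l * v l k" for l k
    unfolding v_def using assms(4,5) by (rule weighted_column_variance)
  \<comment> \<open>Up to the factor \<open>\<pi> $ l\<close> the excess is a weighted sum of
    squares; its sign is what the renewal identity requires.\<close>
  have v0: "0 \<le> v l k" for l k
  proof -
    have "0 \<le> \<pi> $ l * v l k"
      unfolding var[symmetric] by (intro sum_nonneg mult_nonneg_nonneg less_imp_le[OF pos]) simp
    then show ?thesis using pos[of l] by (simp add: zero_le_mult_iff)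
  qed

  \<comment> \<open>\<open>E t i\<close> is the second moment of error component \<open>i\<close> at
    time \<open>t\<close>, and \<open>S t\<close> below is the average of these under
    \<open>\<pi>\<close>.\<close>
  define E where "E t i = (\<Sum>k<t. \<Sum>l\<in>UNIV. (\<sigma> l)\<^sup>2 * (matrix_power P k $ i $ l - \<pi> $ l)\<^sup>2)" for t i
  have E0: "0 \<le> E t i" for t i unfolding E_def by (intro sum_nonneg) simp
  define S where "S t = (\<Sum>i\<in>UNIV. \<pi> $ i * E t i)" for t
  have S0: "0 \<le> S t" for t
    unfolding S_def by (intro sum_nonneg mult_nonneg_nonneg less_imp_le[OF pos] E0)
  have S_eq: "S t = (\<Sum>l\<in>UNIV. (\<sigma> l)\<^sup>2 * \<pi> $ l * (\<Sum>k<t. v l k))" for t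
  proof -
    have "S t = (\<Sum>i\<in>UNIV. \<Sum>k<t. \<Sum>l\<in>UNIV. (\<sigma> l)\<^sup>2 * (\<pi> $ i * (matrix_power P k $ i $ l - \<pi> $ l)\<^sup>2))"
      unfolding S_def E_def sum_distrib_left by (intro sum.cong) auto
    also have "\<dots> = (\<Sum>k<t. \<Sum>l\<in>UNIV. (\<sigma> l)\<^sup>2 * (\<pi> $ l * v l k))"
      unfolding var[symmetric] sum_distrib_left
      by (subst sum.swap, rule sum.cong[OF refl], rule sum.swap)
    also have "\<dots> = (\<Sum>l\<in>UNIV. (\<sigma> l)\<^sup>2 * \<pi> $ l * (\<Sum>k<t. v l k))"
      by (subst sum.swap) (simp add: sum_distrib_left mult.assoc)
    finally show ?thesis .
  qed

  \<comment> \<open>Of the two factors \<open>\<pi> $ l\<close>, one is absorbed by the renewal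
    identity and the other is the factor in the variance identity.\<close>
  have R_eq: "?R = (\<Sum>l\<in>UNIV. ennreal ((\<sigma> l)\<^sup>2 * \<pi> $ l) * (\<Sum>k. ennreal (v l k)))"
  proof (rule sum.cong[OF refl])
    fix l
    have "(\<Sum>j\<in>UNIV. ennreal ((\<sigma> l)\<^sup>2 * (\<pi> $ l)\<^sup>2 * \<pi> $ j) * hitting_time (P ** P) j l) =
        ennreal ((\<sigma> l)\<^sup>2 * \<pi> $ l) * (ennreal (\<pi> $ l) * (\<Sum>j\<in>UNIV. ennreal (\<pi> $ j) * hitting_time (P ** P) j l))"
      unfolding sum_distrib_left
    proof (rule sum.cong[OF refl])
      fix j
      have eq: "(\<sigma> l)\<^sup>2 * (\<pi> $ l)\<^sup>2 * \<pi> $ j = (\<sigma> l)\<^sup>2 * \<pi> $ l * (\<pi> $ l * \<pi> $ j)"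
        by (simp add: power2_eq_square)
      show "ennreal ((\<sigma> l)\<^sup>2 * (\<pi> $ l)\<^sup>2 * \<pi> $ j) * hitting_time (P ** P) j l =
          ennreal ((\<sigma> l)\<^sup>2 * \<pi> $ l) * (ennreal (\<pi> $ l) * (ennreal (\<pi> $ j) * hitting_time (P ** P) j l))"
        unfolding eq using less_imp_le[OF pos] by (simp add: ennreal_mult mult.assoc)
    qed
    also have "ennreal (\<pi> $ l) * (\<Sum>j\<in>UNIV. ennreal (\<pi> $ j) * hitting_time (P ** P) j l) = (\<Sum>k. ennreal (v l k))"
      unfolding v_def sum_weighted_hitting_time[OF Q less_imp_le[OF pos]]
      using v0[of l] by (intro stationary_return_excess[symmetric] Q stQ st pos) (simp add: v_def)
    finally show "(\<Sum>j\<in>UNIV. ennreal ((\<sigma> l)\<^sup>2 * (\<pi> $ l)\<^sup>2 * \<pi> $ j) * hitting_time (P ** P) j l) =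
        ennreal ((\<sigma> l)\<^sup>2 * \<pi> $ l) * (\<Sum>k. ennreal (v l k))" .
  qed
  \<comment> \<open>Series in \<open>ennreal\<close> always converge, so \<open>S\<close> tends to
    \<open>?R\<close> even when \<open>?R\<close> is infinite.\<close>
  have "(\<lambda>t. \<Sum>l\<in>UNIV. ennreal ((\<sigma> l)\<^sup>2 * \<pi> $ l) * (\<Sum>k<t. ennreal (v l k))) \<longlonglongrightarrow> ?R"
    unfolding R_eq
    by (intro tendsto_sum ennreal_tendsto_cmult summable_LIMSEQ summableI) simp
  moreover have "(\<Sum>l\<in>UNIV. ennreal ((\<sigma> l)\<^sup>2 * \<pi> $ l) * (\<Sum>k<t. ennreal (v l k))) = ennreal (S t)" for t
    unfolding S_eq using v0 less_imp_le[OF pos]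
    by (simp add: sum_nonneg flip: ennreal_mult)
  ultimately have S_lim: "(\<lambda>t. ennreal (S t)) \<longlonglongrightarrow> ?R" by simp
  have lim: "limsup (\<lambda>t. ennreal c * ennreal (S t)) = ennreal c * ?R" for c
    by (intro lim_imp_Limsup ennreal_tendsto_cmult S_lim) simp_all

  have ss: "steady_state_disagreement \<Omega> P \<pi> w = limsup (\<lambda>t. ennreal (1 / ?n * (\<Sum>i\<in>UNIV. E t i)))"
    unfolding steady_state_disagreement_def nn_integral_consensus_error[OF assms(6) st(1)] E_def[symmetric]
    by (simp add: E0 sum_nonneg flip: ennreal_mult)
  \<comment> \<open>The weights are replaced by their extremes at each fixed \<open>t\<close>; the
    comparison then passes to the limsup, which for \<open>S\<close> is a true limit.\<close>
  have "S t \<le> ?max * (\<Sum>i\<in>UNIV. E t i)" for t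
    unfolding S_def sum_distrib_left by (intro sum_mono mult_right_mono max E0)
  then have lower: "1 / (?n * ?max) * S t \<le> 1 / ?n * (\<Sum>i\<in>UNIV. E t i)" for t
    using max_pos by (simp add: field_simps)
  have "?min * (\<Sum>i\<in>UNIV. E t i) \<le> S t" for t
    unfolding S_def sum_distrib_left by (intro sum_mono mult_right_mono min E0)
  then have upper: "1 / ?n * (\<Sum>i\<in>UNIV. E t i) \<le> 1 / (?n * ?min) * S t" for t
    using min_pos by (simp add: field_simps)
  have "ennreal (1 / (?n * ?max)) * ?R \<le> steady_state_disagreement \<Omega> P \<pi> w"
    unfolding ss lim[symmetric]
    by (intro Limsup_mono always_eventually allI)
      (use lower S0 max_pos in \<open>simp add: ennreal_leI flip: ennreal_mult\<close>)
  moreover have "steady_state_disagreement \<Omega> P \<pi> w \<le> ennreal (1 / (?n * ?min)) * ?R"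
    unfolding ss lim[symmetric]
    by (intro Limsup_mono always_eventually allI)
      (use upper S0 less_imp_le[OF pos] in \<open>simp add: ennreal_leI flip: ennreal_mult\<close>)
  ultimately show ?thesis by simp
qed

end
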